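(* Let $F$ be a forest with $n$ vertices and no isolated vertices. Then $$\frac12\big(n+|\mathit{Deg}_1(F)|-|\mathit{Supp}(F)|\big)\le\beta(F)\le\frac23\big(n+|\mathit{Deg}_1(F)|-|\mathit{Supp}(F)|\big).$$
   Context: $\beta(F)$ is the independence number of $F$. $\mathit{Deg}_1(F)$ is the set of leaves (vertices of degree $1$). $\mathit{Supp}(F)$ is the set of support vertices, i.e., vertices adjacent to at least one leaf (in a component that is a single edge, both endpoints are leaves and support vertices). *)

theory Defs
  imports "Graph_Theory.Graph_Theory"
begin

text \<open>
  A finite simple undirected graph is a digraph satisfying the locale predicate
  \<^const>\<open>graph\<close>: finite, symmetric, without loops and without parallel arcs. Every
  undirected edge is represented by its two opposite arcs, so the degree of a vertex is its
  out-degree, and adjacency of \<open>u\<close> and \<open>v\<close> is \<open>u \<rightarrow>\<^bsub>G\<^esub> v\<close>.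
\<close>

text \<open>
  The library's \<^const>\<open>forest\<close> is not usable here: traversing an edge back and forth is a
  \<^const>\<open>pre_digraph.cycle\<close> of length 2, so a symmetric digraph with at least one arc is never a
  \<^const>\<open>forest\<close>. The cycles of an undirected graph are the cycles of length at least 3.
\<close>

definition undirected_forest :: "('a, 'b) pre_digraph \<Rightarrow> bool" where
  "undirected_forest G \<longleftrightarrow> graph G \<and> \<not> (\<exists>p. pre_digraph.cycle G p \<and> 3 \<le> length p)"

definition isolated_vertex :: "('a, 'b) pre_digraph \<Rightarrow> 'a \<Rightarrow> bool" where
  "isolated_vertex G v \<longleftrightarrow> v \<in> verts G \<and> out_degree G v = 0"

definition leaves :: "('a, 'b) pre_digraph \<Rightarrow> 'a set" where
  "leaves G = {v \<in> verts G. out_degree G v = 1}"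

definition support_vertices :: "('a, 'b) pre_digraph \<Rightarrow> 'a set" where
  "support_vertices G = {v \<in> verts G. \<exists>u \<in> leaves G. v \<rightarrow>\<^bsub>G\<^esub> u}"

definition independent_set :: "('a, 'b) pre_digraph \<Rightarrow> 'a set \<Rightarrow> bool" where
  "independent_set G S \<longleftrightarrow> S \<subseteq> verts G \<and> (\<forall>u \<in> S. \<forall>v \<in> S. \<not> u \<rightarrow>\<^bsub>G\<^esub> v)"

definition independence_number :: "('a, 'b) pre_digraph \<Rightarrow> nat" where
  "independence_number G = Max (card ` {S. independent_set G S})"

end

theory Submission
  imports Defs
begin

text \<open>
  Let \<open>V\<close>, \<open>L\<close>, \<open>S\<close> be the vertices, leaves and support vertices.

  Lower bound: the leaves outside \<open>S\<close> have all their neighbours in \<open>S\<close>, so adding to them one colour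
  class of a proper 2-colouring of \<open>(V - (L \<union> S)) \<union> (L \<inter> S)\<close> gives an independent set. The two sets
  obtained in this way have \<open>|V| + |L| - |S|\<close> elements together.

  Upper bound: let \<open>I\<close> be independent with complement \<open>C\<close>. Every vertex of \<open>I - L\<close> has at least two
  neighbours in \<open>C\<close>, which in a forest forces \<open>|I - L| \<le> |C|\<close>. A support vertex lies in \<open>C\<close> or has a
  private leaf outside \<open>I\<close>, so \<open>|S| \<le> |C| + |L - I|\<close>. Adding these and \<open>|S| \<le> |L|\<close> gives the bound.
\<close>

definition cycle_free :: "('a \<Rightarrow> 'a \<Rightarrow> bool) \<Rightarrow> bool" where
  "cycle_free R \<longleftrightarrow>
     \<not> (\<exists>xs. distinct xs \<and> 3 \<le> length xs \<and> successively R xs \<and> R (last xs) (hd xs))"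

lemma cycle_free_mono:
  assumes "cycle_free R" and "\<And>x y. Q x y \<Longrightarrow> R x y"
  shows "cycle_free Q"
  unfolding cycle_free_def
proof (intro notI, elim exE conjE)
  fix xs
  assume xs: "distinct xs" "3 \<le> length xs" "successively Q xs" "Q (last xs) (hd xs)"
  have "successively R xs" using successively_mono[OF xs(3)] assms(2) by blast
  then show False using assms xs unfolding cycle_free_def by blast
qed

text \<open>The first vertex of a longest path in \<open>V\<close> has this property: all its
  neighbours in \<open>V\<close> lie on the path, and a second one would close a cycle.\<close>

lemma cycle_free_low_degree:
  fixes R :: "'a \<Rightarrow> 'a \<Rightarrow> bool"
  assumes acyc: "cycle_free R" and symR: "symp R" and irr: "irreflp R"
    and fin: "finite V" and ne: "V \<noteq> {}"
  obtains v where "v \<in> V" and "\<And>x y. x \<in> V \<Longrightarrow> y \<in> V \<Longrightarrow> R v x \<Longrightarrow> R v y \<Longrightarrow> x = y"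
proof (rule ccontr)
  note witness = that
  assume "\<not> thesis"
  then have two: "\<exists>x\<in>V. \<exists>y\<in>V. R v x \<and> R v y \<and> x \<noteq> y" if "v \<in> V" for v
    using that witness by meson
  define path where "path xs \<longleftrightarrow> xs \<noteq> [] \<and> distinct xs \<and> set xs \<subseteq> V \<and> successively R xs"
    for xs
  obtain v0 where "v0 \<in> V" using ne by blast
  then have "path [v0]" by (simp add: path_def)
  moreover have "\<forall>xs. path xs \<longrightarrow> length xs \<le> card V"
    using fin by (metis card_mono distinct_card path_def)
  ultimately have "\<exists>xs. path xs \<and> (\<forall>ys. path ys \<longrightarrow> length ys \<le> length xs)"
    using ex_has_greatest_nat[of path "[v0]" length "Suc (card V)"]
    by (simp add: less_Suc_eq_le)
  then obtain xs where xs: "path xs" and longest: "\<And>ys. path ys \<Longrightarrow> length ys \<le> length xs"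
    by metis
  obtain x zs where xs_eq: "xs = x # zs" using xs unfolding path_def by (meson neq_Nil_conv)
  have x: "x \<in> V" using xs xs_eq by (simp add: path_def)
  have in_zs: "u \<in> set zs" if "u \<in> V" "R x u" for u
  proof (rule ccontr)
    assume "u \<notin> set zs"
    moreover have "u \<noteq> x" using irreflpD[OF irr] that by blast
    moreover have "R u x" using sympD[OF symR] that by blast
    ultimately have "path (u # xs)" using xs that(1) unfolding path_def xs_eq by simp
    from longest[OF this] show False by simp
  qed
  obtain y ys where zs_eq: "zs = y # ys"
    using in_zs two[OF x] by (metis list.set_cases)
  \<comment> \<open>\<open>y\<close> follows \<open>x\<close> on the path, so another neighbour
    \<open>u\<close> of \<open>x\<close> comes later, and the segment from \<open>x\<close> to
    \<open>u\<close> has at least three vertices.\<close>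
  obtain u where u: "u \<in> V" "R x u" "u \<noteq> y" using two[OF x] by metis
  then have "u \<in> set ys" using in_zs zs_eq by auto
  then obtain p q where "ys = p @ u # q" by (meson split_list)
  then have "xs = (x # y # p @ [u]) @ q" using xs_eq zs_eq by simp
  then have "distinct (x # y # p @ [u])" "successively R (x # y # p @ [u])"
    using xs unfolding path_def by (metis distinct_append, metis successively_append_iff)
  moreover have "R u x" using sympD[OF symR] u by blast
  moreover have "\<not> (distinct ws \<and> 3 \<le> length ws \<and> successively R ws \<and> R (last ws) (hd ws))"
    for ws
    using acyc unfolding cycle_free_def by blast
  from this[of "x # y # p @ [u]"]
  have "\<not> (distinct (x # y # p @ [u]) \<and> successively R (x # y # p @ [u]) \<and> R u x)"
    by simp
  ultimately show False by blast
qed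

text \<open>Induction removing a vertex with at most one neighbour in \<open>V\<close>: some colour
  remains free for it.\<close>

lemma cycle_free_two_colouring:
  fixes R :: "'a \<Rightarrow> 'a \<Rightarrow> bool"
  assumes acyc: "cycle_free R" and symR: "symp R" and irr: "irreflp R" and fin: "finite V"
  shows "\<exists>c :: 'a \<Rightarrow> bool. \<forall>x\<in>V. \<forall>y\<in>V. R x y \<longrightarrow> c x \<noteq> c y"
  using fin
proof (induction V rule: finite_psubset_induct)
  case (psubset V)
  show ?case
  proof (cases "V = {}")
    case False
    obtain v where v: "v \<in> V" and low: "\<And>x y. x \<in> V \<Longrightarrow> y \<in> V \<Longrightarrow> R v x \<Longrightarrow> R v y \<Longrightarrow> x = y"
      using cycle_free_low_degree[OF acyc symR irr psubset.hyps False] by metis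
    obtain c :: "'a \<Rightarrow> bool" where c: "\<forall>x\<in>V - {v}. \<forall>y\<in>V - {v}. R x y \<longrightarrow> c x \<noteq> c y"
      using psubset.IH[of "V - {v}"] v by blast
    obtain b where b: "\<And>x. x \<in> V \<Longrightarrow> R v x \<Longrightarrow> c x \<noteq> b"
      using low by metis
    have "\<forall>x\<in>V. \<forall>y\<in>V. R x y \<longrightarrow> (c(v := b)) x \<noteq> (c(v := b)) y"
      using b c sympD[OF symR] irreflpD[OF irr] by (metis Diff_iff fun_upd_apply singletonD)
    then show ?thesis by blast
  qed simp
qed

text \<open>Induction deleting a vertex of \<open>C\<close> with at most one neighbour in
  \<open>A\<close>, together with that neighbour. The rest of \<open>A\<close> loses no neighbour in
  \<open>C\<close>.\<close>

lemma cycle_free_card_le: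
  fixes R :: "'a \<Rightarrow> 'a \<Rightarrow> bool"
  assumes acyc: "cycle_free R" and symR: "symp R" and irr: "irreflp R"
    and "finite A" and "finite C" and "A \<inter> C = {}"
    and "\<And>a. a \<in> A \<Longrightarrow> \<exists>x\<in>C. \<exists>y\<in>C. R a x \<and> R a y \<and> x \<noteq> y"
  shows "card A \<le> card C"
  using assms(4-)
proof (induction "card C" arbitrary: A C)
  case 0
  then show ?case by (cases "A = {}") auto
next
  case (Suc n)
  \<comment> \<open>Keeping only edges with exactly one end in \<open>A\<close> makes the low-degree
    vertex count just \<open>A\<close>-\<open>C\<close> edges. Vertices of \<open>A\<close> still
    have two neighbours, so it must lie in \<open>C\<close>.\<close>
  define Q where "Q x y \<longleftrightarrow> R x y \<and> (x \<in> A \<longleftrightarrow> y \<notin> A)" for x y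
  have "cycle_free Q" "symp Q" "irreflp Q"
    using cycle_free_mono[OF acyc, of Q] symR irr
    by (auto simp: Q_def symp_def irreflp_def)
  moreover have "A \<union> C \<noteq> {}" using Suc.hyps by auto
  ultimately obtain v where v: "v \<in> A \<union> C"
    and low: "\<And>x y. x \<in> A \<union> C \<Longrightarrow> y \<in> A \<union> C \<Longrightarrow> Q v x \<Longrightarrow> Q v y \<Longrightarrow> x = y"
    using cycle_free_low_degree[of Q "A \<union> C"] Suc.prems by (metis finite_UnI)
  have "v \<notin> A"
  proof
    assume "v \<in> A"
    then obtain x y where xy: "x \<in> C" "y \<in> C" "R v x" "R v y" "x \<noteq> y"
      using Suc.prems by metis
    then have "Q v x" "Q v y" using \<open>v \<in> A\<close> Suc.prems by (auto simp: Q_def)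
    then show False using low xy by blast
  qed
  then have vC: "v \<in> C" using v by blast
  define B where "B = {a \<in> A. R a v}"
  have "a = b" if "a \<in> B" "b \<in> B" for a b
    using low[of a b] that \<open>v \<notin> A\<close> sympD[OF symR] by (auto simp: B_def Q_def)
  then have "card B \<le> 1"
    by (metis One_nat_def card_le_Suc0_iff_eq card.infinite zero_le)
  moreover have "card (A - B) \<le> card (C - {v})"
  proof (rule Suc.hyps(1))
    show "n = card (C - {v})" using Suc.hyps(2) vC Suc.prems by simp
    show "\<exists>x\<in>C - {v}. \<exists>y\<in>C - {v}. R a x \<and> R a y \<and> x \<noteq> y" if "a \<in> A - B" for a
      using Suc.prems(4)[of a] that by (auto simp: B_def)
  qed (use Suc.prems in auto)
  moreover have "card (A - B) = card A - card B"
    using Suc.prems by (intro card_Diff_subset) (auto simp: B_def)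
  ultimately show ?case using vC Suc.prems Suc.hyps(2) by simp
qed

text \<open>Bridges the vertex lists of \<open>cycle_free\<close> and the arc lists of
  \<open>cycle\<close>.\<close>

lemma (in wf_digraph) successively_dominates_awalk:
  assumes "successively (\<lambda>u v. u \<rightarrow>\<^bsub>G\<^esub> v) xs" and "xs \<noteq> []" and "hd xs \<in> verts G"
  shows "\<exists>p. awalk (hd xs) p (last xs) \<and> awalk_verts (hd xs) p = xs"
  using assms
proof (induction xs)
  case (Cons x xs)
  show ?case
  proof (cases xs)
    case Nil
    then show ?thesis using Cons.prems by (auto intro!: exI[of _ "[]"] simp: awalk_Nil_iff)
  next
    case (Cons y ys)
    then have "x \<rightarrow>\<^bsub>G\<^esub> y" and "successively (\<lambda>u v. u \<rightarrow>\<^bsub>G\<^esub> v) xs"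
      using Cons.prems by auto
    then obtain p where p: "awalk y p (last xs)" "awalk_verts y p = xs"
      using Cons.IH Cons adj_in_verts(2) by fastforce
    obtain e where "e \<in> arcs G" "tail G e = x" "head G e = y"
      using \<open>x \<rightarrow>\<^bsub>G\<^esub> y\<close> by blast
    then show ?thesis using p Cons by (auto intro!: exI[of _ "e # p"] simp: awalk_Cons_iff)
  qed
qed simp

lemma undirected_forest_cycle_free:
  assumes "undirected_forest G"
  shows "cycle_free (\<lambda>u v. u \<rightarrow>\<^bsub>G\<^esub> v)"
  unfolding cycle_free_def
proof (intro notI, elim exE conjE)
  fix xs
  assume xs: "distinct xs" "3 \<le> length xs" "successively (\<lambda>u v. u \<rightarrow>\<^bsub>G\<^esub> v) xs"
    "last xs \<rightarrow>\<^bsub>G\<^esub> hd xs"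
  interpret graph G using assms by (simp add: undirected_forest_def)
  obtain p where p: "awalk (hd xs) p (last xs)" "awalk_verts (hd xs) p = xs"
    using successively_dominates_awalk[OF xs(3)] xs(2,4) adj_in_verts(2) by fastforce
  \<comment> \<open>The closing arc goes in front, so that \<open>tl\<close> of the vertex list is
    exactly \<open>xs\<close>, and \<open>e # p\<close> has as many arcs as \<open>xs\<close> has
    vertices.\<close>
  obtain e where e: "e \<in> arcs G" "tail G e = last xs" "head G e = hd xs"
    using xs(4) by blast
  have "awalk (last xs) (e # p) (last xs)" using e p by (auto simp: awalk_Cons_iff)
  moreover have "distinct (tl (awalk_verts (last xs) (e # p)))" using e p xs by simp
  ultimately have "cycle (e # p)" unfolding cycle_def by blast
  moreover have "length (awalk_verts (hd xs) p) = Suc (length p)"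
    by (rule length_awalk_verts)
  then have "3 \<le> length (e # p)" using xs p by simp
  ultimately show False using assms by (auto simp: undirected_forest_def)
qed

lemma (in digraph) out_degree_eq_card_dominates:
  "out_degree G v = card {w. v \<rightarrow>\<^bsub>G\<^esub> w}"
proof -
  have "{w. v \<rightarrow>\<^bsub>G\<^esub> w} = head G ` out_arcs G v"
    by (auto simp: arcs_ends_conv out_arcs_def)
  moreover have "inj_on (head G) (out_arcs G v)"
    using no_multi_arcs by (auto simp: inj_on_def arc_to_ends_def)
  ultimately show ?thesis by (simp add: card_image out_degree_def)
qed

theorem theorem11:
  fixes F :: "('a, 'b) pre_digraph" and n :: nat
  assumes "undirected_forest F"
    and "card (verts F) = n"
    and "\<not> (\<exists>v. isolated_vertex F v)"
  shows "1 / 2 * (real n + real (card (leaves F)) - real (card (support_vertices F)))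
           \<le> real (independence_number F)
       \<and> real (independence_number F)
           \<le> 2 / 3 * (real n + real (card (leaves F)) - real (card (support_vertices F)))"
proof -
  interpret graph F using assms by (simp add: undirected_forest_def)
  define R where "R u v \<longleftrightarrow> u \<rightarrow>\<^bsub>F\<^esub> v" for u v
  define V L S where "V = verts F" and "L = leaves F" and "S = support_vertices F"
  have acyc: "cycle_free R"
    using undirected_forest_cycle_free[OF assms(1)] unfolding R_def .
  have symR: "symp R" using arcs_ends_symmetric[OF sym_arcs] by (auto simp: symp_def R_def)
  have irr: "irreflp R" using adj_not_same by (auto simp: irreflp_def R_def)
  have RV: "u \<in> V" "v \<in> V" if "R u v" for u v
    using that adj_in_verts by (auto simp: R_def V_def)
  have finV: "finite V" by (simp add: V_def)
  have LV: "L \<subseteq> V" and SV: "S \<subseteq> V"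
    by (auto simp: L_def S_def V_def leaves_def support_vertices_def)
  have fin: "finite L" "finite S" using LV SV finV finite_subset by auto
  have deg: "out_degree F v = card {w. R v w}" for v
    by (simp add: out_degree_eq_card_dominates R_def)
  have leaf_nb: "v = w" if "u \<in> L" "R u v" "R u w" for u v w
  proof -
    have "card {w. R u w} = 1" using that deg by (simp add: L_def leaves_def)
    then show ?thesis using that by (metis card_1_singletonE mem_Collect_eq singletonD)
  qed
  have L_nb: "v \<in> S" if "u \<in> L" "R u v" for u v
  proof -
    have "R v u" using sympD[OF symR] that by blast
    then show ?thesis
      using that RV by (auto simp: S_def support_vertices_def L_def V_def R_def)
  qed
  have S_nb: "\<exists>u\<in>L. R s u" if "s \<in> S" for s
    using that by (auto simp: S_def support_vertices_def L_def R_def)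
  have two: "\<exists>x y. R v x \<and> R v y \<and> x \<noteq> y" if "v \<in> V - L" for v
  proof -
    have "card {w. R v w} \<noteq> 0" "card {w. R v w} \<noteq> 1"
      using that assms(3) deg by (auto simp: isolated_vertex_def L_def leaves_def V_def)
    then have "\<not> card {w. R v w} \<le> Suc 0" by linarith
    \<comment> \<open>An infinite set would have \<open>card\<close> 0, so finiteness comes for
      free.\<close>
    then show ?thesis by (metis card.infinite card_le_Suc0_iff_eq le0 mem_Collect_eq)
  qed
  \<comment> \<open>\<open>l\<close> picks a private leaf for each support vertex; it is injective
    because a leaf has only one neighbour.\<close>
  obtain l where l: "\<And>s. s \<in> S \<Longrightarrow> l s \<in> L \<and> R s (l s)" using S_nb by metis
  have inj_l: "inj_on l S"
    by (rule inj_onI) (metis l leaf_nb symR sympD)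
  have SL: "card S \<le> card L"
    using card_inj_on_le[OF inj_l] l fin by blast
  have indep_iff: "independent_set F I \<longleftrightarrow> I \<subseteq> V \<and> (\<forall>u\<in>I. \<forall>v\<in>I. \<not> R u v)" for I
    by (simp add: independent_set_def V_def R_def)
  have fin_indep: "finite {I. independent_set F I}"
    using finV by (auto simp: indep_iff intro: finite_subset[OF _ finite_Pow_iff[THEN iffD2]])
  have upper_indep: "3 * card I + 2 * card S \<le> 2 * card V + 2 * card L"
    if I: "independent_set F I" for I
  proof -
    define C where "C = V - I"
    have IV: "I \<subseteq> V" and I_nb: "\<And>u v. u \<in> I \<Longrightarrow> R u v \<Longrightarrow> v \<in> C"
      using I RV by (auto simp: indep_iff C_def)
    have finI: "finite I" "finite C" using IV finV finite_subset by (auto simp: C_def)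
    have "card (I - L) \<le> card C"
    proof (rule cycle_free_card_le[OF acyc symR irr])
      fix a assume "a \<in> I - L"
      then show "\<exists>x\<in>C. \<exists>y\<in>C. R a x \<and> R a y \<and> x \<noteq> y"
        using two[of a] I_nb IV by blast
    qed (use finI in \<open>auto simp: C_def\<close>)
    moreover have "card (S \<inter> C) \<le> card C" using finI by (simp add: card_mono)
    \<comment> \<open>A support vertex in \<open>I\<close> forces its private leaf out of
      \<open>I\<close>.\<close>
    moreover have "card (S \<inter> I) \<le> card (L - I)"
      by (rule card_inj_on_le[of l])
        (use inj_l l I_nb fin in \<open>auto simp: C_def intro: inj_on_subset\<close>)
    moreover have "card S = card (S \<inter> C) + card (S \<inter> I)"
      using SV fin by (subst card_Un_disjoint[symmetric]) (auto simp: C_def intro: arg_cong[of _ _ card])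
    moreover have "card V = card I + card C"
      using IV finI finV by (simp add: C_def card_Diff_subset card_mono)
    moreover have "card I = card (I - L) + card (L \<inter> I)"
      using finI by (subst card_Un_disjoint[symmetric]) (auto intro: arg_cong[of _ _ card])
    moreover have "card L = card (L - I) + card (L \<inter> I)"
      using fin by (subst card_Un_disjoint[symmetric]) (auto intro: arg_cong[of _ _ card])
    \<comment> \<open>Since |V| = |I| + |C|, the goal is |I| + 2|S| \<le> 2|C| + 2|L|. It is the sum
      of |I| \<le> |C| + |L \<inter> I|, |S| \<le> |C| + |L - I| and |S| \<le> |L|.\<close>
    ultimately show ?thesis using SL by linarith
  qed
  obtain c :: "'a \<Rightarrow> bool" where c: "\<And>x y. R x y \<Longrightarrow> c x \<noteq> c y"
    using cycle_free_two_colouring[OF acyc symR irr finV] RV by metis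
  define T where "T = V - (L \<union> S) \<union> L \<inter> S"
  \<comment> \<open>A vertex of \<open>L \<inter> S\<close> lies in a component that is a single edge; only one endpoint of each
    such edge is admitted.\<close>
  define J where "J b = {v \<in> T. c v = b} \<union> (L - S)" for b
  have indep_J: "independent_set F (J b)" for b
  proof -
    have J_sub: "J b \<subseteq> V" using LV by (auto simp: J_def T_def)
    \<comment> \<open>A neighbour \<open>v\<close> of the leaf \<open>u\<close> lies in
      \<open>S\<close>. The only members of \<open>J b\<close> in \<open>S\<close> are leaves, and a
      leaf \<open>v\<close> would put \<open>u\<close> into \<open>S\<close>.\<close>
    have "\<not> R u v" if "u \<in> L - S" "v \<in> J b" for u v
      using that L_nb[of u v] L_nb[of v u] sympD[OF symR, of u v]
      by (auto simp: J_def T_def)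
    moreover have "\<not> R u v" if "u \<in> J b" "v \<in> J b" "u \<notin> L - S" "v \<notin> L - S" for u v
      using that c by (auto simp: J_def)
    ultimately show ?thesis
      using sympD[OF symR] J_sub unfolding indep_iff by metis
  qed
  \<comment> \<open>The colour classes partition \<open>T\<close>, while \<open>L - S\<close> is
    counted twice.\<close>
  have card_J: "card (J True) + card (J False) + card S = card V + card L"
  proof -
    have finT: "finite T" using finV fin by (simp add: T_def)
    have J: "card (J b) = card {v \<in> T. c v = b} + card (L - S)" for b
      unfolding J_def using finT fin by (subst card_Un_disjoint) (auto simp: T_def)
    have "card T = card {v \<in> T. c v = True} + card {v \<in> T. c v = False}"
      using finT by (subst card_Un_disjoint[symmetric]) (auto intro: arg_cong[of _ _ card])
    moreover have "card T = card (V - (L \<union> S)) + card (L \<inter> S)"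
      unfolding T_def using finV fin by (subst card_Un_disjoint) auto
    moreover have "card V = card (V - (L \<union> S)) + card (L \<union> S)"
      using finV LV SV by (simp add: card_Diff_subset card_mono finite_subset)
    moreover have "card (L \<union> S) = card (L - S) + card S"
      using fin by (subst card_Un_disjoint[symmetric]) auto
    moreover have "card L = card (L - S) + card (L \<inter> S)"
      using fin by (subst card_Un_disjoint[symmetric]) (auto intro: arg_cong[of _ _ card])
    ultimately show ?thesis using J by simp
  qed
  have "card (J b) \<le> independence_number F" for b
    unfolding independence_number_def using fin_indep indep_J by (intro Max_ge) auto
  from this[of True] this[of False]
  have "card V + card L \<le> 2 * independence_number F + card S"
    using card_J by linarith
  \<comment> \<open>The maximum is attained, so \<open>upper_indep\<close> applies to a largest
    independent set.\<close>
  moreover have "independence_number F \<in> card ` {I. independent_set F I}"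
    unfolding independence_number_def using fin_indep indep_J by (intro Max_in) auto
  then have "3 * independence_number F + 2 * card S \<le> 2 * card V + 2 * card L"
    using upper_indep by auto
  \<comment> \<open>The counts were kept additive in the naturals; subtraction and division enter
    only over the reals, where nothing is truncated.\<close>
  ultimately have "real (card V + card L) \<le> real (2 * independence_number F + card S)"
    and "real (3 * independence_number F + 2 * card S) \<le> real (2 * card V + 2 * card L)"
    by (simp_all only: of_nat_le_iff)
  then show ?thesis
    using assms(2) unfolding V_def[symmetric] L_def[symmetric] S_def[symmetric]
    by auto
qed

end
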